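(* Let $B\in\mathbb Z^{n\times n}$ be a skew-symmetric matrix. If $\mathrm{Ker}(B)\cap\mathbb Z_{\ge0}^n=0$, then the rule $$\mathbf a\preceq_B\mathbf b\iff\mathbf a-\mathbf b\in B(\mathbb Z_{\ge0}^n)$$ defines a partial order on $\mathbb Z^n$.
   Context: $\mathbb Z_{\ge0}^n$ is the set of integer vectors with non-negative entries and $B(\mathbb Z_{\ge0}^n)$ its image under $B$. *)

theory Defs
  imports "HOL-Analysis.Cartesian_Space"
begin

definition skew_symmetric :: "int ^ 'n ^ 'n \<Rightarrow> bool" where
  "skew_symmetric B \<longleftrightarrow> transpose B = - B"

definition Ker :: "int ^ 'n ^ 'n \<Rightarrow> (int ^ 'n) set" where
  "Ker B = {x. B *v x = 0}"

definition nonneg_vecs :: "(int ^ 'n) set" where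
  "nonneg_vecs = {x. \<forall>i. 0 \<le> x $ i}"

(* The pair (a, b) belongs to dom_rel B iff b dominates a; note the orientation:
   a lies below b when a - b, not b - a, is in the image of the non-negative vectors. *)
definition dom_rel :: "int ^ 'n ^ 'n \<Rightarrow> ((int ^ 'n) \<times> (int ^ 'n)) set" where
  "dom_rel B = {(a, b). a - b \<in> (\<lambda>x. B *v x) ` nonneg_vecs}"

end

theory Submission
  imports Defs
begin

text \<open>
  The set \<open>B(\<int>\<^sub>\<ge>\<^sub>0\<^sup>n)\<close> is a submonoid of \<open>\<int>\<^sup>n\<close>, being the image of a submonoid under an additive
  map. Membership of a difference in a submonoid is always a reflexive and transitive relation;
  it is antisymmetric exactly when the submonoid is pointed, that is, contains no nonzero
  element together with its negative. Pointedness is where the kernel enters: if \<open>v = B x\<close> and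
  \<open>- v = B y\<close> with \<open>x, y \<ge> 0\<close>, then \<open>x + y\<close> is a non-negative element of the kernel, hence zero,
  and non-negative vectors can only cancel if both vanish.
\<close>

lemma zero_in_nonneg_vecs: "0 \<in> nonneg_vecs"
  by (simp add: nonneg_vecs_def)

lemma add_in_nonneg_vecs: "x \<in> nonneg_vecs \<Longrightarrow> y \<in> nonneg_vecs \<Longrightarrow> x + y \<in> nonneg_vecs"
  by (simp add: nonneg_vecs_def)

lemma nonneg_vecs_add_eq_0:
  assumes "x \<in> nonneg_vecs" "y \<in> nonneg_vecs" "x + y = 0"
  shows "x = 0"
  using assms by (simp add: nonneg_vecs_def vec_eq_iff add_nonneg_eq_0_iff)

lemma zero_in_image_nonneg_vecs: "0 \<in> (\<lambda>x. B *v x) ` nonneg_vecs"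
  using zero_in_nonneg_vecs by (force intro: image_eqI[where x = 0])

lemma add_in_image_nonneg_vecs:
  assumes "u \<in> (\<lambda>x. B *v x) ` nonneg_vecs" "v \<in> (\<lambda>x. B *v x) ` nonneg_vecs"
  shows "u + v \<in> (\<lambda>x. B *v x) ` nonneg_vecs"
  using assms add_in_nonneg_vecs by (force simp: matrix_vector_right_distrib[symmetric])

lemma image_nonneg_vecs_pointed:
  assumes "Ker B \<inter> nonneg_vecs = {0}"
    and "v \<in> (\<lambda>x. B *v x) ` nonneg_vecs" "- v \<in> (\<lambda>x. B *v x) ` nonneg_vecs"
  shows "v = 0"
proof -
  obtain x y where x: "x \<in> nonneg_vecs" "v = B *v x" and y: "y \<in> nonneg_vecs" "- v = B *v y"
    using assms(2,3) by blast
  have "B *v (x + y) = 0"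
    by (simp add: matrix_vector_right_distrib flip: x(2) y(2))
  then have "x + y \<in> Ker B \<inter> nonneg_vecs"
    using add_in_nonneg_vecs[OF x(1) y(1)] by (simp add: Ker_def)
  then have "x = 0"
    using assms(1) nonneg_vecs_add_eq_0[OF x(1) y(1)] by simp
  then show ?thesis
    using x(2) by simp
qed

theorem lemma3p1:
  fixes B :: "int ^ 'n ^ 'n"
  assumes "skew_symmetric B"
    and "Ker B \<inter> nonneg_vecs = {0}"
  shows "partial_order_on UNIV (dom_rel B)"
proof -
  have "refl (dom_rel B)"
    by (simp add: refl_on_def dom_rel_def zero_in_image_nonneg_vecs)
  moreover have "trans (dom_rel B)"
  proof (rule transI)
    fix a b c
    assume "(a, b) \<in> dom_rel B" "(b, c) \<in> dom_rel B"
    then show "(a, c) \<in> dom_rel B"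
      using add_in_image_nonneg_vecs[of "a - b" B "b - c"] by (simp add: dom_rel_def)
  qed
  moreover have "antisym (dom_rel B)"
  proof (rule antisymI)
    fix a b
    assume "(a, b) \<in> dom_rel B" "(b, a) \<in> dom_rel B"
    then show "a = b"
      using image_nonneg_vecs_pointed[OF assms(2), of "a - b"] by (simp add: dom_rel_def)
  qed
  ultimately show ?thesis
    by (simp add: partial_order_on_def preorder_on_def)
qed

end
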